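(* Let $\Lambda$ be a row-finite $\ell$-graph without sources and $f:\mathbb{N}^k\to\mathbb{N}^\ell$ a monoid homomorphism, extended to a group homomorphism $f:\mathbb{Z}^k\to\mathbb{Z}^\ell$. Regard $T_\Lambda$ as a $\mathbb{Z}^\ell$-monoid in the usual way, and also as a $\mathbb{Z}^k$-monoid via ${}^{\mathbf{q}}a:={}^{f(\mathbf{q})}a$ for $\mathbf{q}\in\mathbb{Z}^k$, $a\in T_\Lambda$. Then there exists a monoid homomorphism $\rho:T_{f^*(\Lambda)}\to T_\Lambda$ such that $$(\mathrm{id},\rho):(\mathbb{Z}^k,T_{f^*(\Lambda)})\to(\mathbb{Z}^k,T_\Lambda),\quad (f,\mathrm{id}):(\mathbb{Z}^k,T_\Lambda)\to(\mathbb{Z}^\ell,T_\Lambda),\quad (f,\rho):(\mathbb{Z}^k,T_{f^*(\Lambda)})\to(\mathbb{Z}^\ell,T_\Lambda)$$ are equivariant homomorphisms and the triangle commutes, i.e. $(f,\mathrm{id})\circ(\mathrm{id},\rho)=(f,\rho)$ in the category $\mathbf{Grp\text{-}Mon}$; and, if $f$ is surjective, then $\rho$ is an isomorphism.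
   Context: $\mathbb{N}=\{0,1,2,\dots\}$; $\mathbf{e}_i$ is the $i$-th unit vector. A $k$-graph is a countable small category $\Lambda$ with a functor $d:\Lambda\to\mathbb{N}^k$ (degree) such that whenever $d(\lambda)=\mathbf{n}+\mathbf{m}$ with $\mathbf{n},\mathbf{m}\in\mathbb{N}^k$ there are unique $\alpha,\beta\in\Lambda$ with $d(\alpha)=\mathbf{n}$, $d(\beta)=\mathbf{m}$, $\lambda=\alpha\beta$. The codomain and domain of a morphism $\lambda$ are $r(\lambda)$ and $s(\lambda)$; $\lambda\mu$ is defined when $s(\lambda)=r(\mu)$. $\Lambda^{\mathbf{n}}=d^{-1}(\mathbf{n})$; elements of $\Lambda^0$ are identified with objects (vertices). $v\Lambda^{\mathbf{n}}=\{\lambda\in\Lambda^{\mathbf{n}}:r(\lambda)=v\}$. $\Lambda$ is row-finite without sources if $0<|v\Lambda^{\mathbf{n}}|<\infty$ for all $v,\mathbf{n}$. The talented monoid $T_\Lambda$ of a row-finite $k$-graph without sources is the commutative monoid generated by symbols $v(\mathbf{n})$ ($v\in\Lambda^0$, $\mathbf{n}\in\mathbb{Z}^k$) subject to $v(\mathbf{n})=\sum_{\alpha\in v\Lambda^{\mathbf{e}_i}}s(\alpha)(\mathbf{n}+\mathbf{e}_i)$ for all $v,\mathbf{n}$ and $1\le i\le k$; $\mathbb{Z}^k$ acts by ${}^{\mathbf{q}}v(\mathbf{n})=v(\mathbf{n}+\mathbf{q})$. For an $\ell$-graph $\Lambda$ and a monoid homomorphism $f:\mathbb{N}^k\to\mathbb{N}^\ell$,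 the pullback $k$-graph is $f^*(\Lambda)=\{(\lambda,\mathbf{n})\in\Lambda\times\mathbb{N}^k: d(\lambda)=f(\mathbf{n})\}$ with $r(\lambda,\mathbf{n})=(r(\lambda),0)$, $s(\lambda,\mathbf{n})=(s(\lambda),0)$, $(\lambda,\mathbf{m})(\mu,\mathbf{n})=(\lambda\mu,\mathbf{m}+\mathbf{n})$, degree $d(\lambda,\mathbf{n})=\mathbf{n}$; its vertices $(v,0)$ are identified with $v\in\Lambda^0$. A pair $(\Gamma,M)$ is a group $\Gamma$ with a commutative monoid $M$ on which $\Gamma$ acts by monoid automorphisms. An equivariant homomorphism $(\Gamma,M)\to(\Delta,N)$ is a pair $(g,\rho)$ of a group homomorphism $g:\Gamma\to\Delta$ and a monoid homomorphism $\rho:M\to N$ with $\rho({}^\gamma x)={}^{g(\gamma)}\rho(x)$ for all $\gamma\in\Gamma,x\in M$. These pairs and equivariant homomorphisms (composed componentwise) form the category $\mathbf{Grp\text{-}Mon}$. *)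

theory Defs
  imports
    "HOL-Algebra.Bij"
    "HOL-Library.Function_Algebras"
    "HOL-Library.Multiset"
    "HOL-Library.Countable_Set"
begin

text \<open>
  The \<open>k\<close>-tuples over \<open>'a\<close> are the functions on \<^typ>\<open>nat\<close> that vanish from index \<open>k\<close> on, with
  pointwise addition. Over \<^typ>\<open>nat\<close> this is the monoid \<open>\<nat>\<^sup>k\<close>, over \<^typ>\<open>int\<close> the group \<open>\<int>\<^sup>k\<close>
  (\<open>k = 0\<close> is allowed). Coordinates are numbered \<open>0, \<dots>, k - 1\<close>.
\<close>

definition tuples :: "nat \<Rightarrow> (nat \<Rightarrow> 'a::comm_monoid_add) monoid" where
  "tuples k = \<lparr>carrier = {n. \<forall>i\<ge>k. n i = 0}, monoid.mult = (+), one = 0\<rparr>"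

abbreviation Nvec :: "nat \<Rightarrow> (nat \<Rightarrow> nat) monoid" where
  "Nvec \<equiv> tuples"

abbreviation Zvec :: "nat \<Rightarrow> (nat \<Rightarrow> int) monoid" where
  "Zvec \<equiv> tuples"

definition unit_tuple :: "nat \<Rightarrow> nat \<Rightarrow> 'a::zero_neq_one" where
  "unit_tuple i = (\<lambda>j. if j = i then 1 else 0)"

text \<open>Homomorphisms of monoids preserve the unit, which \<^const>\<open>hom\<close> does not demand.\<close>

definition monoid_homs :: "('a, 'c) monoid_scheme \<Rightarrow> ('b, 'd) monoid_scheme \<Rightarrow> ('a \<Rightarrow> 'b) set" where
  "monoid_homs M N = {h \<in> hom M N. h \<one>\<^bsub>M\<^esub> = \<one>\<^bsub>N\<^esub>}"


text \<open>
  A small category is given by its morphisms alone, each object being identified with its identity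
  morphism. So codomain \<open>kg_r\<close> and domain \<open>kg_s\<close> take values in the identity morphisms, and
  \<open>kg_comp \<Lambda> x y\<close> is meaningful only if \<open>kg_s \<Lambda> x = kg_r \<Lambda> y\<close>.
\<close>

record 'a kgraph =
  kg_mor :: "'a set"
  kg_r :: "'a \<Rightarrow> 'a"
  kg_s :: "'a \<Rightarrow> 'a"
  kg_comp :: "'a \<Rightarrow> 'a \<Rightarrow> 'a"
  kg_d :: "'a \<Rightarrow> nat \<Rightarrow> nat"

locale small_category =
  fixes \<Lambda> :: "'a kgraph"
  assumes r_closed: "x \<in> kg_mor \<Lambda> \<Longrightarrow> kg_r \<Lambda> x \<in> kg_mor \<Lambda>"
    and s_closed: "x \<in> kg_mor \<Lambda> \<Longrightarrow> kg_s \<Lambda> x \<in> kg_mor \<Lambda>"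
    and r_r: "x \<in> kg_mor \<Lambda> \<Longrightarrow> kg_r \<Lambda> (kg_r \<Lambda> x) = kg_r \<Lambda> x"
    and s_r: "x \<in> kg_mor \<Lambda> \<Longrightarrow> kg_s \<Lambda> (kg_r \<Lambda> x) = kg_r \<Lambda> x"
    and r_s: "x \<in> kg_mor \<Lambda> \<Longrightarrow> kg_r \<Lambda> (kg_s \<Lambda> x) = kg_s \<Lambda> x"
    and s_s: "x \<in> kg_mor \<Lambda> \<Longrightarrow> kg_s \<Lambda> (kg_s \<Lambda> x) = kg_s \<Lambda> x"
    and comp_closed: "\<lbrakk>x \<in> kg_mor \<Lambda>; y \<in> kg_mor \<Lambda>; kg_s \<Lambda> x = kg_r \<Lambda> y\<rbrakk>
      \<Longrightarrow> kg_comp \<Lambda> x y \<in> kg_mor \<Lambda>"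
    and r_comp: "\<lbrakk>x \<in> kg_mor \<Lambda>; y \<in> kg_mor \<Lambda>; kg_s \<Lambda> x = kg_r \<Lambda> y\<rbrakk>
      \<Longrightarrow> kg_r \<Lambda> (kg_comp \<Lambda> x y) = kg_r \<Lambda> x"
    and s_comp: "\<lbrakk>x \<in> kg_mor \<Lambda>; y \<in> kg_mor \<Lambda>; kg_s \<Lambda> x = kg_r \<Lambda> y\<rbrakk>
      \<Longrightarrow> kg_s \<Lambda> (kg_comp \<Lambda> x y) = kg_s \<Lambda> y"
    and comp_assoc: "\<lbrakk>x \<in> kg_mor \<Lambda>; y \<in> kg_mor \<Lambda>; z \<in> kg_mor \<Lambda>;
        kg_s \<Lambda> x = kg_r \<Lambda> y; kg_s \<Lambda> y = kg_r \<Lambda> z\<rbrakk>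
      \<Longrightarrow> kg_comp \<Lambda> (kg_comp \<Lambda> x y) z = kg_comp \<Lambda> x (kg_comp \<Lambda> y z)"
    and comp_r: "x \<in> kg_mor \<Lambda> \<Longrightarrow> kg_comp \<Lambda> (kg_r \<Lambda> x) x = x"
    and comp_s: "x \<in> kg_mor \<Lambda> \<Longrightarrow> kg_comp \<Lambda> x (kg_s \<Lambda> x) = x"

locale k_graph = small_category \<Lambda> for k :: nat and \<Lambda> :: "'a kgraph" +
  assumes countable_mor: "countable (kg_mor \<Lambda>)"
    and d_closed: "x \<in> kg_mor \<Lambda> \<Longrightarrow> kg_d \<Lambda> x \<in> carrier (Nvec k)"
    and d_identity: "x \<in> kg_mor \<Lambda> \<Longrightarrow> kg_d \<Lambda> (kg_r \<Lambda> x) = 0"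
    and d_comp: "\<lbrakk>x \<in> kg_mor \<Lambda>; y \<in> kg_mor \<Lambda>; kg_s \<Lambda> x = kg_r \<Lambda> y\<rbrakk>
      \<Longrightarrow> kg_d \<Lambda> (kg_comp \<Lambda> x y) = kg_d \<Lambda> x + kg_d \<Lambda> y"
    and factorization: "\<lbrakk>x \<in> kg_mor \<Lambda>; n \<in> carrier (Nvec k); m \<in> carrier (Nvec k);
        kg_d \<Lambda> x = n + m\<rbrakk>
      \<Longrightarrow> \<exists>!(\<alpha>, \<beta>). \<alpha> \<in> kg_mor \<Lambda> \<and> \<beta> \<in> kg_mor \<Lambda> \<and> kg_s \<Lambda> \<alpha> = kg_r \<Lambda> \<beta> \<and>
            kg_d \<Lambda> \<alpha> = n \<and> kg_d \<Lambda> \<beta> = m \<and> x = kg_comp \<Lambda> \<alpha> \<beta>"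

definition kg_vertices :: "'a kgraph \<Rightarrow> 'a set" where
  "kg_vertices \<Lambda> = {v \<in> kg_mor \<Lambda>. kg_d \<Lambda> v = 0}"

definition kg_paths :: "'a kgraph \<Rightarrow> 'a \<Rightarrow> (nat \<Rightarrow> nat) \<Rightarrow> 'a set" where
  "kg_paths \<Lambda> v n = {x \<in> kg_mor \<Lambda>. kg_d \<Lambda> x = n \<and> kg_r \<Lambda> x = v}"

definition row_finite_no_sources :: "nat \<Rightarrow> 'a kgraph \<Rightarrow> bool" where
  "row_finite_no_sources k \<Lambda> \<longleftrightarrow>
     (\<forall>v \<in> kg_vertices \<Lambda>. \<forall>n \<in> carrier (Nvec k). finite (kg_paths \<Lambda> v n) \<and> kg_paths \<Lambda> v n \<noteq> {})"

definition pullback_kgraph ::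
    "nat \<Rightarrow> ((nat \<Rightarrow> nat) \<Rightarrow> nat \<Rightarrow> nat) \<Rightarrow> 'a kgraph \<Rightarrow> ('a \<times> (nat \<Rightarrow> nat)) kgraph" where
  "pullback_kgraph k f \<Lambda> =
     \<lparr>kg_mor = {(x, n). x \<in> kg_mor \<Lambda> \<and> n \<in> carrier (Nvec k) \<and> kg_d \<Lambda> x = f n},
      kg_r = (\<lambda>(x, n). (kg_r \<Lambda> x, 0)),
      kg_s = (\<lambda>(x, n). (kg_s \<Lambda> x, 0)),
      kg_comp = (\<lambda>(x, m) (y, n). (kg_comp \<Lambda> x y, m + n)),
      kg_d = snd\<rparr>"


text \<open>
  The commutative monoid with generators \<open>S\<close> and relations \<open>R\<close>: the free commutative monoid on
  \<open>S\<close>, i.e. the finite multisets over \<open>S\<close>, modulo the least congruence containing \<open>R\<close>.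
\<close>

inductive_set gen_congruence :: "'g set \<Rightarrow> ('g multiset \<times> 'g multiset) set
    \<Rightarrow> ('g multiset \<times> 'g multiset) set"
  for S :: "'g set" and R :: "('g multiset \<times> 'g multiset) set" where
  base: "\<lbrakk>(a, b) \<in> R; set_mset a \<subseteq> S; set_mset b \<subseteq> S\<rbrakk> \<Longrightarrow> (a, b) \<in> gen_congruence S R"
| refl: "set_mset a \<subseteq> S \<Longrightarrow> (a, a) \<in> gen_congruence S R"
| sym: "(a, b) \<in> gen_congruence S R \<Longrightarrow> (b, a) \<in> gen_congruence S R"
| trans: "\<lbrakk>(a, b) \<in> gen_congruence S R; (b, c) \<in> gen_congruence S R\<rbrakk>
    \<Longrightarrow> (a, c) \<in> gen_congruence S R"
| add: "\<lbrakk>(a, b) \<in> gen_congruence S R; set_mset c \<subseteq> S\<rbrakk> \<Longrightarrow> (a + c, b + c) \<in> gen_congruence S R"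

definition presented_comm_monoid ::
    "'g set \<Rightarrow> ('g multiset \<times> 'g multiset) set \<Rightarrow> 'g multiset set monoid" where
  "presented_comm_monoid S R =
     \<lparr>carrier = {a. set_mset a \<subseteq> S} // gen_congruence S R,
      monoid.mult = (\<lambda>A B. \<Union>a\<in>A. \<Union>b\<in>B. gen_congruence S R `` {a + b}),
      one = gen_congruence S R `` {{#}}\<rparr>"


text \<open>The pair \<open>(v, n)\<close> stands for the generator \<open>v(n)\<close> of the talented monoid.\<close>

definition talented_generators :: "nat \<Rightarrow> 'a kgraph \<Rightarrow> ('a \<times> (nat \<Rightarrow> int)) set" where
  "talented_generators k \<Lambda> = kg_vertices \<Lambda> \<times> carrier (Zvec k)"

definition talented_relations :: "nat \<Rightarrow> 'a kgraph
    \<Rightarrow> (('a \<times> (nat \<Rightarrow> int)) multiset \<times> ('a \<times> (nat \<Rightarrow> int)) multiset) set" where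
  "talented_relations k \<Lambda> =
     {({#(v, n)#},
       \<Sum>\<alpha> \<in> kg_paths \<Lambda> v (unit_tuple i). {#(kg_s \<Lambda> \<alpha>, n + unit_tuple i)#}) | v n i.
       v \<in> kg_vertices \<Lambda> \<and> n \<in> carrier (Zvec k) \<and> i < k}"

definition talented_monoid :: "nat \<Rightarrow> 'a kgraph \<Rightarrow> ('a \<times> (nat \<Rightarrow> int)) multiset set monoid" where
  "talented_monoid k \<Lambda> =
     presented_comm_monoid (talented_generators k \<Lambda>) (talented_relations k \<Lambda>)"

text \<open>
  Replacing every \<open>v(n)\<close> by \<open>v(n + q)\<close> permutes the congruence classes, so the induced map on the
  quotient takes each class to its image.
\<close>

definition talented_action :: "nat \<Rightarrow> 'a kgraph \<Rightarrow> (nat \<Rightarrow> int)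
    \<Rightarrow> ('a \<times> (nat \<Rightarrow> int)) multiset set \<Rightarrow> ('a \<times> (nat \<Rightarrow> int)) multiset set" where
  "talented_action k \<Lambda> q =
     (\<lambda>A \<in> carrier (talented_monoid k \<Lambda>). image_mset (\<lambda>(v, n). (v, n + q)) ` A)"


record ('g, 'm) grp_mon =
  gm_grp :: "'g monoid"
  gm_mon :: "'m monoid"
  gm_act :: "'g \<Rightarrow> 'm \<Rightarrow> 'm"

definition is_grp_mon :: "('g, 'm) grp_mon \<Rightarrow> bool" where
  "is_grp_mon X \<longleftrightarrow> group (gm_grp X) \<and> comm_monoid (gm_mon X) \<and>
     gm_act X \<in> hom (gm_grp X) (AutoGroup (gm_mon X))"

text \<open>Morphisms of the category \<open>Grp-Mon\<close>: two pairs of maps that agree on carriers are the same arrow.\<close>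

definition equivariant_hom ::
    "('g, 'm) grp_mon \<Rightarrow> ('h, 'n) grp_mon \<Rightarrow> ('g \<Rightarrow> 'h) \<times> ('m \<Rightarrow> 'n) \<Rightarrow> bool" where
  "equivariant_hom X Y = (\<lambda>(g, \<rho>).
     is_grp_mon X \<and> is_grp_mon Y \<and>
     g \<in> hom (gm_grp X) (gm_grp Y) \<and> \<rho> \<in> monoid_homs (gm_mon X) (gm_mon Y) \<and>
     (\<forall>\<gamma> \<in> carrier (gm_grp X). \<forall>x \<in> carrier (gm_mon X).
        \<rho> (gm_act X \<gamma> x) = gm_act Y (g \<gamma>) (\<rho> x)))"

definition grp_mon_comp ::
    "('h \<Rightarrow> 'i) \<times> ('n \<Rightarrow> 'p) \<Rightarrow> ('g \<Rightarrow> 'h) \<times> ('m \<Rightarrow> 'n) \<Rightarrow> ('g \<Rightarrow> 'i) \<times> ('m \<Rightarrow> 'p)" where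
  "grp_mon_comp = (\<lambda>(g', \<rho>') (g, \<rho>). (g' \<circ> g, \<rho>' \<circ> \<rho>))"

definition talented_grp_mon ::
    "nat \<Rightarrow> 'a kgraph \<Rightarrow> (nat \<Rightarrow> int, ('a \<times> (nat \<Rightarrow> int)) multiset set) grp_mon" where
  "talented_grp_mon k \<Lambda> =
     \<lparr>gm_grp = Zvec k, gm_mon = talented_monoid k \<Lambda>, gm_act = talented_action k \<Lambda>\<rparr>"

definition restrict_action ::
    "'h monoid \<Rightarrow> ('h \<Rightarrow> 'g) \<Rightarrow> ('g, 'm) grp_mon \<Rightarrow> ('h, 'm) grp_mon" where
  "restrict_action H F X =
     \<lparr>gm_grp = H, gm_mon = gm_mon X, gm_act = (\<lambda>q. gm_act X (F q))\<rparr>"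

end

theory Submission
  imports Defs
begin

text \<open>
  The homomorphism is induced by \<open>v(n) \<mapsto> v(F n)\<close>. It respects the relations because the defining
  relations along unit tuples imply, by unique factorization, the relation
  \<open>v(n) = \<Sum> s(\<alpha>)(n + p)\<close> over \<open>\<alpha> \<in> v\<Lambda>\<^sup>p\<close> for every degree \<open>p\<close>.
  If \<open>F\<close> is surjective, any section \<open>G\<close> of \<open>F\<close> induces the inverse \<open>v(m) \<mapsto> v(G m)\<close>. Both facts
  needed for this follow from one relation in the talented monoid of the pullback: if
  \<open>F q = p \<ge> 0\<close>, then \<open>v(n) = \<Sum> s(\<alpha>)(n + q)\<close> over \<open>\<alpha> \<in> v\<Lambda>\<^sup>p\<close>. To see it, write
  \<open>q = a - b\<close> with \<open>a, b \<ge> 0\<close>, so that \<open>f a = p + f b\<close>; expanding \<open>v(n)\<close> along \<open>a\<close> and each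
  \<open>s(\<alpha>)(n + q)\<close> along \<open>b\<close> gives the same sum.
\<close>

section \<open>Presented commutative monoids\<close>

lemma gen_congruence_closed:
  "(a, b) \<in> gen_congruence S R \<Longrightarrow> set_mset a \<subseteq> S \<and> set_mset b \<subseteq> S"
  by (induction rule: gen_congruence.induct) auto

lemma equiv_gen_congruence: "equiv {a. set_mset a \<subseteq> S} (gen_congruence S R)"
proof (rule equivI)
  show "gen_congruence S R \<subseteq> {a. set_mset a \<subseteq> S} \<times> {a. set_mset a \<subseteq> S}"
    using gen_congruence_closed by fastforce
  show "refl_on {a. set_mset a \<subseteq> S} (gen_congruence S R)"
    by (auto intro: refl_onI gen_congruence.refl)
  show "sym (gen_congruence S R)"
    by (auto intro: symI gen_congruence.sym)
  show "trans (gen_congruence S R)"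
    by (auto intro: transI gen_congruence.trans)
qed

text \<open>The rule \<open>add\<close> translates by one fixed multiset, so the two summands are
  replaced one after the other; commutativity brings the second into position.\<close>

lemma gen_congruence_add:
  assumes "(a, b) \<in> gen_congruence S R" "(c, d) \<in> gen_congruence S R"
  shows "(a + c, b + d) \<in> gen_congruence S R"
proof -
  have "(a + c, b + c) \<in> gen_congruence S R"
    using assms gen_congruence_closed by (blast intro: gen_congruence.add)
  moreover have "(c + b, d + b) \<in> gen_congruence S R"
    using assms gen_congruence_closed by (blast intro: gen_congruence.add)
  ultimately show ?thesis
    by (metis gen_congruence.trans add.commute)
qed

text \<open>If \<open>A\<close> is infinite, both sums are the empty multiset and reflexivity
  applies.\<close>

lemma gen_congruence_sum:
  assumes "\<And>x. x \<in> A \<Longrightarrow> (g x, h x) \<in> gen_congruence S R"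
  shows "(sum g A, sum h A) \<in> gen_congruence S R"
  using assms
  by (induction A rule: infinite_finite_induct) (auto intro: gen_congruence.refl gen_congruence_add)

text \<open>Serves the round trip in \<open>map_iso\<close>: a map that moves each generator only
  within its class acts trivially on all classes.\<close>

lemma gen_congruence_image_mset_self:
  assumes "\<And>x. x \<in> S \<Longrightarrow> ({#\<phi> x#}, {#x#}) \<in> gen_congruence S R" "set_mset a \<subseteq> S"
  shows "(image_mset \<phi> a, a) \<in> gen_congruence S R"
  using assms(2)
proof (induction a)
  case empty
  then show ?case by (auto intro: gen_congruence.refl)
next
  case (add x a)
  then show ?case
    using gen_congruence_add[OF assms(1)[of x], of "image_mset \<phi> a" a] by auto
qed

text \<open>Pairs whose images under \<open>\<phi>\<close> are congruent form a congruence
  containing \<open>R\<close>, and \<open>gen_congruence S R\<close> is the least one.\<close>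

lemma gen_congruence_image_mset:
  assumes "(a, b) \<in> gen_congruence S R" and "\<phi> ` S \<subseteq> S'"
    and "\<And>a b. (a, b) \<in> R \<Longrightarrow> set_mset a \<subseteq> S \<Longrightarrow> set_mset b \<subseteq> S \<Longrightarrow>
      (image_mset \<phi> a, image_mset \<phi> b) \<in> gen_congruence S' R'"
  shows "(image_mset \<phi> a, image_mset \<phi> b) \<in> gen_congruence S' R'"
  using assms(1)
proof (induction rule: gen_congruence.induct)
  case (base a b)
  then show ?case using assms(3) by blast
next
  case (refl a)
  with assms(2) have "set_mset (image_mset \<phi> a) \<subseteq> S'" by auto
  then show ?case by (rule gen_congruence.refl)
next
  case (sym a b)
  then show ?case by (blast intro: gen_congruence.sym)
next
  case (trans a b c)
  then show ?case by (blast intro: gen_congruence.trans)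
next
  case (add a b c)
  with assms(2) have "set_mset (image_mset \<phi> c) \<subseteq> S'" by auto
  with add.IH show ?case by (simp add: gen_congruence.add)
qed

lemma one_presented: "\<one>\<^bsub>presented_comm_monoid S R\<^esub> = gen_congruence S R `` {{#}}"
  by (simp add: presented_comm_monoid_def)

lemma class_in_carrier:
  "set_mset a \<subseteq> S \<Longrightarrow> gen_congruence S R `` {a} \<in> carrier (presented_comm_monoid S R)"
  by (auto simp: presented_comm_monoid_def intro: quotientI)

lemma carrier_presentedE:
  assumes "A \<in> carrier (presented_comm_monoid S R)"
  obtains a where "set_mset a \<subseteq> S" "A = gen_congruence S R `` {a}"
  using assms by (auto simp: presented_comm_monoid_def elim!: quotientE)

text \<open>The product is a union over all representatives; by \<open>gen_congruence_add\<close>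
  every choice contributes the same class.\<close>

lemma mult_presented:
  assumes "set_mset a \<subseteq> S" "set_mset b \<subseteq> S"
  shows "gen_congruence S R `` {a} \<otimes>\<^bsub>presented_comm_monoid S R\<^esub> gen_congruence S R `` {b} =
    gen_congruence S R `` {a + b}"
proof -
  have "gen_congruence S R `` {a' + b'} = gen_congruence S R `` {a + b}"
    if "(a, a') \<in> gen_congruence S R" "(b, b') \<in> gen_congruence S R" for a' b'
    using equiv_class_eq[OF equiv_gen_congruence gen_congruence_add[OF that]] by simp
  then have "gen_congruence S R `` {a} \<otimes>\<^bsub>presented_comm_monoid S R\<^esub> gen_congruence S R `` {b} =
      (\<Union>a'\<in>gen_congruence S R `` {a}. \<Union>b'\<in>gen_congruence S R `` {b}. gen_congruence S R `` {a + b})"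
    unfolding presented_comm_monoid_def monoid.simps by (intro SUP_cong) auto
  \<comment> \<open>A union of a constant family collapses to that constant only over a nonempty
    index set.\<close>
  moreover have "a \<in> gen_congruence S R `` {a}" "b \<in> gen_congruence S R `` {b}"
    using assms by (simp_all add: gen_congruence.refl)
  ultimately show ?thesis
    by (metis UN_constant empty_iff)
qed

lemma comm_monoid_presented: "comm_monoid (presented_comm_monoid S R)"
proof (rule comm_monoidI)
  fix x y z
  assume "x \<in> carrier (presented_comm_monoid S R)" "y \<in> carrier (presented_comm_monoid S R)"
    "z \<in> carrier (presented_comm_monoid S R)"
  then obtain a b c where "set_mset a \<subseteq> S" "set_mset b \<subseteq> S" "set_mset c \<subseteq> S"
    "x = gen_congruence S R `` {a}" "y = gen_congruence S R `` {b}" "z = gen_congruence S R `` {c}"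
    by (elim carrier_presentedE)
  then show "x \<otimes>\<^bsub>presented_comm_monoid S R\<^esub> y \<otimes>\<^bsub>presented_comm_monoid S R\<^esub> z =
    x \<otimes>\<^bsub>presented_comm_monoid S R\<^esub> (y \<otimes>\<^bsub>presented_comm_monoid S R\<^esub> z)"
    by (simp add: mult_presented add.assoc)
next
  fix x y
  assume "x \<in> carrier (presented_comm_monoid S R)" "y \<in> carrier (presented_comm_monoid S R)"
  then obtain a b where "set_mset a \<subseteq> S" "set_mset b \<subseteq> S"
    "x = gen_congruence S R `` {a}" "y = gen_congruence S R `` {b}"
    by (elim carrier_presentedE)
  then show "x \<otimes>\<^bsub>presented_comm_monoid S R\<^esub> y \<in> carrier (presented_comm_monoid S R)"
    "x \<otimes>\<^bsub>presented_comm_monoid S R\<^esub> y = y \<otimes>\<^bsub>presented_comm_monoid S R\<^esub> x"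
    by (simp_all add: mult_presented class_in_carrier add.commute)
next
  fix x assume "x \<in> carrier (presented_comm_monoid S R)"
  then show "\<one>\<^bsub>presented_comm_monoid S R\<^esub> \<otimes>\<^bsub>presented_comm_monoid S R\<^esub> x = x"
    by (elim carrier_presentedE) (simp add: mult_presented one_presented)
qed (simp add: one_presented class_in_carrier)

section \<open>Homomorphisms induced by maps of generators\<close>

definition presented_map ::
    "'g set \<Rightarrow> ('g multiset \<times> 'g multiset) set \<Rightarrow> ('h \<Rightarrow> 'g) \<Rightarrow> 'h multiset set \<Rightarrow> 'g multiset set" where
  "presented_map S' R' \<phi> A = (\<Union>a\<in>A. gen_congruence S' R' `` {image_mset \<phi> a})"

text \<open>Only maps taking single generators to single generators are covered; this suffices for
  the shifts, for \<open>to_base\<close> and for the map inducing the inverse of \<open>rho\<close>.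
  As in the rule \<open>base\<close>, only relations between multisets over \<open>S\<close> have to
  be respected.\<close>

locale presented_hom =
  fixes S :: "'g set" and R and S' :: "'h set" and R' and \<phi> :: "'g \<Rightarrow> 'h"
  assumes generators: "\<phi> ` S \<subseteq> S'"
    and relations: "(a, b) \<in> R \<Longrightarrow> set_mset a \<subseteq> S \<Longrightarrow> set_mset b \<subseteq> S \<Longrightarrow>
      (image_mset \<phi> a, image_mset \<phi> b) \<in> gen_congruence S' R'"
begin

lemma congruence:
  "(a, b) \<in> gen_congruence S R \<Longrightarrow> (image_mset \<phi> a, image_mset \<phi> b) \<in> gen_congruence S' R'"
  using gen_congruence_image_mset generators relations by blast

lemma image_generators: "set_mset a \<subseteq> S \<Longrightarrow> set_mset (image_mset \<phi> a) \<subseteq> S'"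
  using generators by auto

text \<open>As for the product, all representatives contribute the same class, here by
  \<open>congruence\<close>, so the union defining \<open>presented_map\<close> is a single
  class.\<close>

lemma map_class:
  assumes "set_mset a \<subseteq> S"
  shows "presented_map S' R' \<phi> (gen_congruence S R `` {a}) = gen_congruence S' R' `` {image_mset \<phi> a}"
proof -
  have "gen_congruence S' R' `` {image_mset \<phi> b} = gen_congruence S' R' `` {image_mset \<phi> a}"
    if "(a, b) \<in> gen_congruence S R" for b
    using equiv_class_eq[OF equiv_gen_congruence congruence[OF that]] by simp
  then have "presented_map S' R' \<phi> (gen_congruence S R `` {a}) =
      (\<Union>b\<in>gen_congruence S R `` {a}. gen_congruence S' R' `` {image_mset \<phi> a})"
    unfolding presented_map_def by (intro SUP_cong) auto
  moreover have "a \<in> gen_congruence S R `` {a}"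
    using assms by (simp add: gen_congruence.refl)
  ultimately show ?thesis
    by (metis UN_constant empty_iff)
qed

lemma map_hom:
  "presented_map S' R' \<phi> \<in> hom (presented_comm_monoid S R) (presented_comm_monoid S' R')"
proof (rule homI)
  fix x assume "x \<in> carrier (presented_comm_monoid S R)"
  then show "presented_map S' R' \<phi> x \<in> carrier (presented_comm_monoid S' R')"
    by (elim carrier_presentedE) (simp add: map_class class_in_carrier image_generators del: set_image_mset)
next
  fix x y
  assume "x \<in> carrier (presented_comm_monoid S R)" "y \<in> carrier (presented_comm_monoid S R)"
  then show "presented_map S' R' \<phi> (x \<otimes>\<^bsub>presented_comm_monoid S R\<^esub> y) =
      presented_map S' R' \<phi> x \<otimes>\<^bsub>presented_comm_monoid S' R'\<^esub> presented_map S' R' \<phi> y"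
    by (elim carrier_presentedE)
      (simp add: map_class mult_presented image_generators del: set_image_mset)
qed

lemma map_monoid_homs:
  "presented_map S' R' \<phi> \<in> monoid_homs (presented_comm_monoid S R) (presented_comm_monoid S' R')"
  using map_hom map_class[of "{#}"] by (simp add: monoid_homs_def one_presented)

text \<open>The conditions are asymmetric because \<open>\<psi>\<close> will come from a section of
  \<open>F\<close>: on generators it is then a strict right inverse of \<open>\<phi>\<close>, but a
  left inverse only up to congruence.\<close>

lemma map_iso:
  assumes "presented_hom S' R' S R \<psi>"
    and "\<And>x. x \<in> S \<Longrightarrow> ({#\<psi> (\<phi> x)#}, {#x#}) \<in> gen_congruence S R"
    and "\<And>y. y \<in> S' \<Longrightarrow> \<phi> (\<psi> y) = y"
  shows "presented_map S' R' \<phi> \<in> iso (presented_comm_monoid S R) (presented_comm_monoid S' R')"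
proof -
  interpret inv: presented_hom S' R' S R \<psi> by fact
  have "bij_betw (presented_map S' R' \<phi>) (carrier (presented_comm_monoid S R))
    (carrier (presented_comm_monoid S' R'))"
  proof (rule bij_betw_byWitness[where f' = "presented_map S R \<psi>"])
    show "\<forall>x\<in>carrier (presented_comm_monoid S R).
        presented_map S R \<psi> (presented_map S' R' \<phi> x) = x"
    proof
      fix x assume "x \<in> carrier (presented_comm_monoid S R)"
      then obtain a where a: "set_mset a \<subseteq> S" "x = gen_congruence S R `` {a}"
        by (elim carrier_presentedE)
      have "(image_mset (\<psi> \<circ> \<phi>) a, a) \<in> gen_congruence S R"
        using gen_congruence_image_mset_self[of S "\<psi> \<circ> \<phi>"] assms(2) a by auto
      from equiv_class_eq[OF equiv_gen_congruence this]
      show "presented_map S R \<psi> (presented_map S' R' \<phi> x) = x"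
        using a image_generators[of a]
        by (simp add: map_class inv.map_class multiset.map_comp del: set_image_mset)
    qed
    show "\<forall>y\<in>carrier (presented_comm_monoid S' R').
        presented_map S' R' \<phi> (presented_map S R \<psi> y) = y"
    proof
      fix y assume "y \<in> carrier (presented_comm_monoid S' R')"
      then obtain a where a: "set_mset a \<subseteq> S'" "y = gen_congruence S' R' `` {a}"
        by (elim carrier_presentedE)
      have "image_mset (\<phi> \<circ> \<psi>) a = image_mset id a"
        using a assms(3) by (intro image_mset_cong) auto
      then show "presented_map S' R' \<phi> (presented_map S R \<psi> y) = y"
        using a inv.image_generators[of a]
        by (simp add: map_class inv.map_class multiset.map_comp del: set_image_mset)
    qed
  qed (use map_hom inv.map_hom in \<open>auto simp: hom_def\<close>)
  with map_hom show ?thesis by (simp add: iso_def)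
qed

end

section \<open>Tuples\<close>

lemma zero_in_tuples [simp]: "0 \<in> carrier (tuples k)"
  by (simp add: tuples_def)

lemma add_in_tuples [simp]:
  "x \<in> carrier (tuples k) \<Longrightarrow> y \<in> carrier (tuples k) \<Longrightarrow> x + y \<in> carrier (tuples k)"
  by (simp add: tuples_def)

lemma uminus_in_tuples [simp]:
  fixes x :: "nat \<Rightarrow> 'a::ab_group_add"
  shows "x \<in> carrier (tuples k) \<Longrightarrow> - x \<in> carrier (tuples k)"
  by (simp add: tuples_def)

lemma diff_in_tuples [simp]:
  fixes x :: "nat \<Rightarrow> 'a::ab_group_add"
  shows "x \<in> carrier (tuples k) \<Longrightarrow> y \<in> carrier (tuples k) \<Longrightarrow> x - y \<in> carrier (tuples k)"
  by (simp add: tuples_def)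

lemma int_in_tuples [simp]:
  "(\<lambda>i. int (p i)) \<in> carrier (tuples k) \<longleftrightarrow> p \<in> carrier (tuples k)"
  by (simp add: tuples_def)

lemma unit_in_tuples: "i < k \<Longrightarrow> (unit_tuple i :: nat \<Rightarrow> 'a::{comm_monoid_add,zero_neq_one}) \<in> carrier (tuples k)"
  by (auto simp: tuples_def unit_tuple_def)

lemma int_unit_tuple: "(\<lambda>j. int (unit_tuple i j)) = unit_tuple i"
  by (auto simp: unit_tuple_def)

lemma mult_tuples [simp]: "x \<otimes>\<^bsub>tuples k\<^esub> y = x + y"
  by (simp add: tuples_def)

lemma one_tuples [simp]: "\<one>\<^bsub>tuples k\<^esub> = 0"
  by (simp add: tuples_def)

lemma group_tuples: "group (tuples k :: (nat \<Rightarrow> 'a::ab_group_add) monoid)"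
proof (rule groupI)
  fix x :: "nat \<Rightarrow> 'a" assume "x \<in> carrier (tuples k)"
  then show "\<exists>y\<in>carrier (tuples k). y \<otimes>\<^bsub>tuples k\<^esub> x = \<one>\<^bsub>tuples k\<^esub>"
    by (intro bexI[of _ "- x"]) auto
qed (auto simp: add.assoc)

text \<open>A tuple is determined by the list of its first \<open>k\<close> entries. This is needed
  for the pullback to have countably many morphisms.\<close>

lemma countable_Nvec: "countable (carrier (Nvec k))"
proof (rule countableI')
  have "x = y" if "x \<in> carrier (Nvec k)" "y \<in> carrier (Nvec k)" "map x [0..<k] = map y [0..<k]" for x y
  proof
    fix i show "x i = y i"
      using that by (cases "i < k") (auto simp: tuples_def)
  qed
  then show "inj_on (\<lambda>x. to_nat (map x [0..<k])) (carrier (Nvec k))"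
    by (auto intro!: inj_onI)
qed

lemma Zvec_as_difference:
  assumes "q \<in> carrier (Zvec k)"
  obtains a b where "a \<in> carrier (Nvec k)" "b \<in> carrier (Nvec k)"
    "q = (\<lambda>i. int (a i)) - (\<lambda>i. int (b i))"
proof
  \<comment> \<open>The positive and negative parts of \<open>q\<close>: the function
    \<open>nat\<close> sends negative integers to 0.\<close>
  show "(\<lambda>i. nat (q i)) \<in> carrier (Nvec k)" "(\<lambda>i. nat (- q i)) \<in> carrier (Nvec k)"
    using assms by (auto simp: tuples_def)
  show "q = (\<lambda>i. int (nat (q i))) - (\<lambda>i. int (nat (- q i)))"
    by auto
qed

text \<open>The talented relations advance by one unit tuple at a time; this induction reaches every
  degree. It runs on the coordinate sum, lowering some nonzero coordinate by one.\<close>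

lemma Nvec_induct [consumes 1, case_names zero unit]:
  assumes "p \<in> carrier (Nvec k)" and zero: "P 0"
    and unit: "\<And>i p. i < k \<Longrightarrow> p \<in> carrier (Nvec k) \<Longrightarrow> P p \<Longrightarrow> P (p + unit_tuple i)"
  shows "P p"
  using assms(1)
proof (induction "\<Sum>i<k. p i" arbitrary: p)
  case 0
  then have "p i = 0" for i
    by (cases "i < k") (auto simp: tuples_def)
  then have "p = 0" by auto
  with zero show "P p" by simp
next
  case (Suc m)
  then obtain i where i: "i < k" "p i \<noteq> 0"
    by (metis lessThan_iff nat.distinct(1) sum.neutral)
  define q where "q = p(i := p i - 1)"
  have p: "p = q + unit_tuple i"
    using i by (auto simp: q_def unit_tuple_def)
  have q: "q \<in> carrier (Nvec k)"
    using Suc.prems i by (auto simp: tuples_def q_def)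
  have "(\<Sum>i<k. p i) = (\<Sum>i<k. q i) + (\<Sum>j<k. unit_tuple i j)"
    by (simp add: p sum.distrib)
  also have "(\<Sum>j<k. unit_tuple i j) = (1 :: nat)"
    using i by (simp add: unit_tuple_def)
  finally have "m = (\<Sum>i<k. q i)"
    using Suc.hyps(2) by simp
  from Suc.hyps(1)[OF this q] show ?case
    using unit i q p by simp
qed

section \<open>Paths in a \<open>k\<close>-graph\<close>

context k_graph
begin

text \<open>Vertices are defined by degree, while identities are the values of \<open>kg_r\<close>
  and \<open>kg_s\<close>. The pairs \<open>(kg_r \<Lambda> v, v)\<close> and
  \<open>(v, kg_s \<Lambda> v)\<close> both factor \<open>v\<close> in degrees 0 and 0, so they
  coincide by unique factorization.\<close>

lemma r_vertex: "v \<in> kg_mor \<Lambda> \<Longrightarrow> kg_d \<Lambda> v = 0 \<Longrightarrow> kg_r \<Lambda> v = v"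
proof -
  assume v: "v \<in> kg_mor \<Lambda>" "kg_d \<Lambda> v = 0"
  \<comment> \<open>\<open>d_identity\<close> speaks of \<open>kg_r\<close> only, but a source is
    its own range.\<close>
  have "kg_d \<Lambda> (kg_s \<Lambda> v) = 0"
    using d_identity[OF s_closed[OF v(1)]] r_s[OF v(1)] by simp
  with factorization[OF v(1), of 0 0] v show "kg_r \<Lambda> v = v"
    using r_closed s_closed s_r r_s comp_r comp_s d_identity
    by (auto simp: case_prod_unfold Ex1_def) (metis prod.inject)
qed

lemma s_in_vertices: "x \<in> kg_mor \<Lambda> \<Longrightarrow> kg_s \<Lambda> x \<in> kg_vertices \<Lambda>"
  using d_identity[OF s_closed] r_s s_closed by (simp add: kg_vertices_def)

lemma s_path_in_vertices: "\<alpha> \<in> kg_paths \<Lambda> v p \<Longrightarrow> kg_s \<Lambda> \<alpha> \<in> kg_vertices \<Lambda>"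
  using s_in_vertices by (simp add: kg_paths_def)

lemma s_vertex: "v \<in> kg_vertices \<Lambda> \<Longrightarrow> kg_s \<Lambda> v = v"
  using r_vertex s_r by (metis (mono_tags, lifting) kg_vertices_def mem_Collect_eq)

lemma paths_zero: "v \<in> kg_vertices \<Lambda> \<Longrightarrow> kg_paths \<Lambda> v 0 = {v}"
  using r_vertex by (auto simp: kg_paths_def kg_vertices_def)

lemma factorizationE:
  assumes "x \<in> kg_mor \<Lambda>" "n \<in> carrier (Nvec k)" "m \<in> carrier (Nvec k)" "kg_d \<Lambda> x = n + m"
  obtains \<alpha> \<beta> where "\<alpha> \<in> kg_mor \<Lambda>" "\<beta> \<in> kg_mor \<Lambda>" "kg_s \<Lambda> \<alpha> = kg_r \<Lambda> \<beta>"
    "kg_d \<Lambda> \<alpha> = n" "kg_d \<Lambda> \<beta> = m" "x = kg_comp \<Lambda> \<alpha> \<beta>"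
  using ex1_implies_ex[OF factorization[OF assms]] by auto

lemma factorization_unique:
  assumes "\<alpha> \<in> kg_mor \<Lambda>" "\<beta> \<in> kg_mor \<Lambda>" "kg_s \<Lambda> \<alpha> = kg_r \<Lambda> \<beta>"
    and "\<alpha>' \<in> kg_mor \<Lambda>" "\<beta>' \<in> kg_mor \<Lambda>" "kg_s \<Lambda> \<alpha>' = kg_r \<Lambda> \<beta>'"
    and "kg_d \<Lambda> \<alpha>' = kg_d \<Lambda> \<alpha>" "kg_d \<Lambda> \<beta>' = kg_d \<Lambda> \<beta>"
    and "kg_comp \<Lambda> \<alpha>' \<beta>' = kg_comp \<Lambda> \<alpha> \<beta>"
  shows "\<alpha>' = \<alpha> \<and> \<beta>' = \<beta>"
proof -
  from factorization[OF comp_closed[OF assms(1-3)] d_closed[OF assms(1)] d_closed[OF assms(2)]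
      d_comp[OF assms(1-3)]]
  obtain w where w: "\<And>\<gamma> \<delta>. \<gamma> \<in> kg_mor \<Lambda> \<Longrightarrow> \<delta> \<in> kg_mor \<Lambda> \<Longrightarrow> kg_s \<Lambda> \<gamma> = kg_r \<Lambda> \<delta> \<Longrightarrow>
      kg_d \<Lambda> \<gamma> = kg_d \<Lambda> \<alpha> \<Longrightarrow> kg_d \<Lambda> \<delta> = kg_d \<Lambda> \<beta> \<Longrightarrow>
      kg_comp \<Lambda> \<alpha> \<beta> = kg_comp \<Lambda> \<gamma> \<delta> \<Longrightarrow> (\<gamma>, \<delta>) = w"
    by (elim ex1E) blast
  have "(\<alpha>, \<beta>) = w"
    by (rule w) (use assms in auto)
  moreover have "(\<alpha>', \<beta>') = w"
    by (rule w) (use assms in auto)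
  ultimately show ?thesis by auto
qed

text \<open>Surjectivity is the existence part of the factorization property, injectivity the
  uniqueness part.\<close>

lemma bij_betw_paths_add:
  assumes "p \<in> carrier (Nvec k)" "q \<in> carrier (Nvec k)"
  shows "bij_betw (\<lambda>(\<alpha>, \<beta>). kg_comp \<Lambda> \<alpha> \<beta>)
    (SIGMA \<alpha> : kg_paths \<Lambda> v p. kg_paths \<Lambda> (kg_s \<Lambda> \<alpha>) q) (kg_paths \<Lambda> v (p + q))"
proof (rule bij_betw_imageI)
  let ?D = "SIGMA \<alpha> : kg_paths \<Lambda> v p. kg_paths \<Lambda> (kg_s \<Lambda> \<alpha>) q"
  have closed: "kg_comp \<Lambda> \<alpha> \<beta> \<in> kg_paths \<Lambda> v (p + q)" if "(\<alpha>, \<beta>) \<in> ?D" for \<alpha> \<beta>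
    using that by (auto simp: kg_paths_def comp_closed d_comp r_comp)
  show "inj_on (\<lambda>(\<alpha>, \<beta>). kg_comp \<Lambda> \<alpha> \<beta>) ?D"
  proof (rule inj_onI)
    fix y z assume y: "y \<in> ?D" and z: "z \<in> ?D"
      and eq: "(\<lambda>(\<alpha>, \<beta>). kg_comp \<Lambda> \<alpha> \<beta>) y = (\<lambda>(\<alpha>, \<beta>). kg_comp \<Lambda> \<alpha> \<beta>) z"
    obtain \<alpha> \<beta> \<alpha>' \<beta>' where yz: "y = (\<alpha>, \<beta>)" "z = (\<alpha>', \<beta>')"
      by (cases y, cases z) auto
    show "y = z"
      using factorization_unique[of \<alpha> \<beta> \<alpha>' \<beta>'] y z eq by (simp add: yz kg_paths_def)
  qed
  show "(\<lambda>(\<alpha>, \<beta>). kg_comp \<Lambda> \<alpha> \<beta>) ` ?D = kg_paths \<Lambda> v (p + q)"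
  proof
    show "(\<lambda>(\<alpha>, \<beta>). kg_comp \<Lambda> \<alpha> \<beta>) ` ?D \<subseteq> kg_paths \<Lambda> v (p + q)"
      using closed by auto
    show "kg_paths \<Lambda> v (p + q) \<subseteq> (\<lambda>(\<alpha>, \<beta>). kg_comp \<Lambda> \<alpha> \<beta>) ` ?D"
    proof
      fix x assume x: "x \<in> kg_paths \<Lambda> v (p + q)"
      then have "x \<in> kg_mor \<Lambda>" "kg_d \<Lambda> x = p + q"
        by (simp_all add: kg_paths_def)
      then obtain \<alpha> \<beta> where "\<alpha> \<in> kg_mor \<Lambda>" "\<beta> \<in> kg_mor \<Lambda>" "kg_s \<Lambda> \<alpha> = kg_r \<Lambda> \<beta>"
        "kg_d \<Lambda> \<alpha> = p" "kg_d \<Lambda> \<beta> = q" "x = kg_comp \<Lambda> \<alpha> \<beta>"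
        using assms by (elim factorizationE[of x p q])
      with x r_comp[of \<alpha> \<beta>] show "x \<in> (\<lambda>(\<alpha>, \<beta>). kg_comp \<Lambda> \<alpha> \<beta>) ` ?D"
        by (intro image_eqI[of _ _ "(\<alpha>, \<beta>)"]) (auto simp: kg_paths_def)
    qed
  qed
qed

text \<open>The summand sees only the source, and a composite has the source of its second factor.
  Row-finiteness makes the index sets of the double sum finite.\<close>

lemma sum_paths_add:
  assumes "row_finite_no_sources k \<Lambda>" "v \<in> kg_vertices \<Lambda>"
    and "p \<in> carrier (Nvec k)" "q \<in> carrier (Nvec k)"
  shows "(\<Sum>\<alpha>\<in>kg_paths \<Lambda> v (p + q). g (kg_s \<Lambda> \<alpha>)) =
    (\<Sum>\<alpha>\<in>kg_paths \<Lambda> v p. \<Sum>\<beta>\<in>kg_paths \<Lambda> (kg_s \<Lambda> \<alpha>) q. g (kg_s \<Lambda> \<beta>))"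
proof -
  have "(\<Sum>\<alpha>\<in>kg_paths \<Lambda> v p. \<Sum>\<beta>\<in>kg_paths \<Lambda> (kg_s \<Lambda> \<alpha>) q. g (kg_s \<Lambda> \<beta>)) =
    (\<Sum>(\<alpha>, \<beta>)\<in>(SIGMA \<alpha> : kg_paths \<Lambda> v p. kg_paths \<Lambda> (kg_s \<Lambda> \<alpha>) q). g (kg_s \<Lambda> \<beta>))"
    using assms s_path_in_vertices by (intro sum.Sigma) (auto simp: row_finite_no_sources_def)
  also have "\<dots> = (\<Sum>y\<in>(SIGMA \<alpha> : kg_paths \<Lambda> v p. kg_paths \<Lambda> (kg_s \<Lambda> \<alpha>) q).
      g (kg_s \<Lambda> ((\<lambda>(\<alpha>, \<beta>). kg_comp \<Lambda> \<alpha> \<beta>) y)))"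
    by (intro sum.cong) (auto simp: kg_paths_def s_comp)
  also have "\<dots> = (\<Sum>\<alpha>\<in>kg_paths \<Lambda> v (p + q). g (kg_s \<Lambda> \<alpha>))"
    by (rule sum.reindex_bij_betw[OF bij_betw_paths_add[OF assms(3,4)]])
  finally show ?thesis by simp
qed

end

section \<open>The talented monoid\<close>

abbreviation talented_congruence where
  "talented_congruence k \<Lambda> \<equiv> gen_congruence (talented_generators k \<Lambda>) (talented_relations k \<Lambda>)"

lemma set_mset_sum_subset:
  "(\<And>x. x \<in> A \<Longrightarrow> set_mset (g x) \<subseteq> S) \<Longrightarrow> set_mset (sum g A) \<subseteq> S"
  by (induction A rule: infinite_finite_induct) auto

lemma image_mset_sum: "image_mset \<phi> (sum g A) = (\<Sum>x\<in>A. image_mset \<phi> (g x))"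
  by (induction A rule: infinite_finite_induct) auto

context k_graph
begin

lemma talented_unit_relation:
  assumes "v \<in> kg_vertices \<Lambda>" "n \<in> carrier (Zvec k)" "i < k"
  shows "({#(v, n)#}, \<Sum>\<alpha>\<in>kg_paths \<Lambda> v (unit_tuple i). {#(kg_s \<Lambda> \<alpha>, n + unit_tuple i)#})
    \<in> talented_congruence k \<Lambda>"
proof (rule gen_congruence.base)
  show "({#(v, n)#}, \<Sum>\<alpha>\<in>kg_paths \<Lambda> v (unit_tuple i). {#(kg_s \<Lambda> \<alpha>, n + unit_tuple i)#})
    \<in> talented_relations k \<Lambda>"
    using assms unfolding talented_relations_def by blast
  show "set_mset {#(v, n)#} \<subseteq> talented_generators k \<Lambda>"
    using assms by (auto simp: talented_generators_def)
  show "set_mset (\<Sum>\<alpha>\<in>kg_paths \<Lambda> v (unit_tuple i). {#(kg_s \<Lambda> \<alpha>, n + unit_tuple i)#})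
    \<subseteq> talented_generators k \<Lambda>"
    using assms s_path_in_vertices
    by (intro set_mset_sum_subset) (auto simp: talented_generators_def unit_in_tuples)
qed

text \<open>In degree 0 the only path is the vertex itself. In the induction step each summand is
  expanded along one further unit tuple, and \<open>sum_paths_add\<close> merges the double sum into
  a sum over paths of degree \<open>p + unit_tuple i\<close>.\<close>

lemma talented_path_relation:
  assumes "row_finite_no_sources k \<Lambda>" "v \<in> kg_vertices \<Lambda>" "n \<in> carrier (Zvec k)"
    and "p \<in> carrier (Nvec k)"
  shows "({#(v, n)#}, \<Sum>\<alpha>\<in>kg_paths \<Lambda> v p. {#(kg_s \<Lambda> \<alpha>, n + (\<lambda>j. int (p j)))#})
    \<in> talented_congruence k \<Lambda>"
  using assms(4)
proof (induction rule: Nvec_induct)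
  case zero
  have "(\<lambda>j. int ((0 :: nat \<Rightarrow> nat) j)) = 0" by auto
  then show ?case
    using assms(2,3) unfolding paths_zero[OF assms(2)]
    by (auto simp: s_vertex talented_generators_def intro!: gen_congruence.refl)
next
  case (unit i p)
  let ?n = "n + (\<lambda>j. int (p j))"
  have shift: "n + (\<lambda>j. int ((p + unit_tuple i) j)) = ?n + unit_tuple i"
    by (auto simp: unit_tuple_def)
  have "(\<Sum>\<alpha>\<in>kg_paths \<Lambda> v p. {#(kg_s \<Lambda> \<alpha>, ?n)#},
      \<Sum>\<alpha>\<in>kg_paths \<Lambda> v p. \<Sum>\<beta>\<in>kg_paths \<Lambda> (kg_s \<Lambda> \<alpha>) (unit_tuple i).
        {#(kg_s \<Lambda> \<beta>, ?n + unit_tuple i)#}) \<in> talented_congruence k \<Lambda>"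
    using unit assms(3) s_path_in_vertices by (intro gen_congruence_sum talented_unit_relation) auto
  also have "(\<Sum>\<alpha>\<in>kg_paths \<Lambda> v p. \<Sum>\<beta>\<in>kg_paths \<Lambda> (kg_s \<Lambda> \<alpha>) (unit_tuple i).
        {#(kg_s \<Lambda> \<beta>, ?n + unit_tuple i)#}) =
      (\<Sum>\<alpha>\<in>kg_paths \<Lambda> v (p + unit_tuple i). {#(kg_s \<Lambda> \<alpha>, ?n + unit_tuple i)#})"
    using sum_paths_add[OF assms(1,2) unit(2) unit_in_tuples[OF unit(1)],
        of "\<lambda>w. {#(w, ?n + unit_tuple i)#}"] by simp
  finally show ?case
    using unit(3) unfolding shift by (blast intro: gen_congruence.trans)
qed

end

section \<open>The shift action on the talented monoid\<close>

lemma presented_hom_shift: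
  assumes "q \<in> carrier (Zvec k)"
  shows "presented_hom (talented_generators k \<Lambda>) (talented_relations k \<Lambda>)
    (talented_generators k \<Lambda>) (talented_relations k \<Lambda>) (\<lambda>(v, n). (v, n + q))"
proof
  show gens: "(\<lambda>(v, n). (v, n + q)) ` talented_generators k \<Lambda> \<subseteq> talented_generators k \<Lambda>"
    using assms by (auto simp: talented_generators_def)
  fix a b
  assume "(a, b) \<in> talented_relations k \<Lambda>"
    and ab: "set_mset a \<subseteq> talented_generators k \<Lambda>" "set_mset b \<subseteq> talented_generators k \<Lambda>"
  then obtain v n i where vni: "v \<in> kg_vertices \<Lambda>" "n \<in> carrier (Zvec k)" "i < k"
    "a = {#(v, n)#}"
    "b = (\<Sum>\<alpha>\<in>kg_paths \<Lambda> v (unit_tuple i). {#(kg_s \<Lambda> \<alpha>, n + unit_tuple i)#})"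
    unfolding talented_relations_def by blast
  \<comment> \<open>The shifted relation is the defining relation for the same vertex and direction,
    based at \<open>n + q\<close>.\<close>
  have "image_mset (\<lambda>(v, n). (v, n + q)) b =
      (\<Sum>\<alpha>\<in>kg_paths \<Lambda> v (unit_tuple i). {#(kg_s \<Lambda> \<alpha>, (n + q) + unit_tuple i)#})"
    by (simp add: vni image_mset_sum ac_simps)
  then have "(image_mset (\<lambda>(v, n). (v, n + q)) a, image_mset (\<lambda>(v, n). (v, n + q)) b)
      \<in> talented_relations k \<Lambda>"
    using vni assms unfolding talented_relations_def by force
  then show "(image_mset (\<lambda>(v, n). (v, n + q)) a, image_mset (\<lambda>(v, n). (v, n + q)) b)
      \<in> talented_congruence k \<Lambda>"
    by (rule gen_congruence.base) (use ab gens in auto)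
qed

lemma image_mset_shift_add:
  fixes p q :: "'b::semigroup_add"
  shows
  "image_mset (\<lambda>(v, n). (v, n + q)) (image_mset (\<lambda>(v, n). (v, n + p)) a) =
    image_mset (\<lambda>(v, n). (v, n + (p + q))) a"
  by (simp add: multiset.map_comp comp_def case_prod_unfold add.assoc)

text \<open>The term \<open>n + 0\<close> is the form in which shifts by \<open>q\<close> and
  \<open>- q\<close> cancel after \<open>image_mset_shift_add\<close>.\<close>

lemma image_mset_shift_zero:
  fixes a :: "('a \<times> 'b::monoid_add) multiset"
  shows "image_mset (\<lambda>(v, n). (v, n + 0)) a = a"
  by (simp add: case_prod_unfold)

text \<open>The action takes images of sets, so compatibility with the congruence gives one
  inclusion only. For the other, the shift by \<open>- q\<close> pulls every member of the target
  class back.\<close>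

lemma talented_action_class:
  assumes "q \<in> carrier (Zvec k)" "set_mset a \<subseteq> talented_generators k \<Lambda>"
  shows "talented_action k \<Lambda> q (talented_congruence k \<Lambda> `` {a}) =
    talented_congruence k \<Lambda> `` {image_mset (\<lambda>(v, n). (v, n + q)) a}"
proof -
  interpret shift: presented_hom "talented_generators k \<Lambda>" "talented_relations k \<Lambda>"
    "talented_generators k \<Lambda>" "talented_relations k \<Lambda>" "\<lambda>(v, n). (v, n + q)"
    using assms(1) by (rule presented_hom_shift)
  interpret unshift: presented_hom "talented_generators k \<Lambda>" "talented_relations k \<Lambda>"
    "talented_generators k \<Lambda>" "talented_relations k \<Lambda>" "\<lambda>(v, n). (v, n + - q)"
    using assms(1) by (intro presented_hom_shift) simp
  have "image_mset (\<lambda>(v, n). (v, n + q)) ` (talented_congruence k \<Lambda> `` {a}) =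
      talented_congruence k \<Lambda> `` {image_mset (\<lambda>(v, n). (v, n + q)) a}" (is "?L = ?R")
  proof
    show "?L \<subseteq> ?R"
      using shift.congruence by auto
    show "?R \<subseteq> ?L"
    proof
      fix b assume "b \<in> ?R"
      then have "(a, image_mset (\<lambda>(v, n). (v, n + - q)) b) \<in> talented_congruence k \<Lambda>"
        using unshift.congruence[of "image_mset (\<lambda>(v, n). (v, n + q)) a" b]
        unfolding image_mset_shift_add right_minus image_mset_shift_zero by simp
      moreover have "b = image_mset (\<lambda>(v, n). (v, n + q)) (image_mset (\<lambda>(v, n). (v, n + - q)) b)"
        unfolding image_mset_shift_add left_minus image_mset_shift_zero by simp
      ultimately show "b \<in> ?L" by blast
    qed
  qed
  moreover have "talented_congruence k \<Lambda> `` {a} \<in> carrier (talented_monoid k \<Lambda>)"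
    unfolding talented_monoid_def using assms(2) by (rule class_in_carrier)
  ultimately show ?thesis
    by (simp add: talented_action_def)
qed

lemma carrier_talentedE:
  assumes "A \<in> carrier (talented_monoid k \<Lambda>)"
  obtains a where "set_mset a \<subseteq> talented_generators k \<Lambda>" "A = talented_congruence k \<Lambda> `` {a}"
  using assms unfolding talented_monoid_def by (rule carrier_presentedE)

lemma set_mset_shift:
  assumes "q \<in> carrier (Zvec k)" "set_mset a \<subseteq> talented_generators k \<Lambda>"
  shows "set_mset (image_mset (\<lambda>(v, n). (v, n + q)) a) \<subseteq> talented_generators k \<Lambda>"
  using assms(2) by (rule presented_hom.image_generators[OF presented_hom_shift[OF assms(1)]])

lemma talented_action_add:
  assumes "p \<in> carrier (Zvec k)" "q \<in> carrier (Zvec k)" "x \<in> carrier (talented_monoid k \<Lambda>)"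
  shows "talented_action k \<Lambda> (p + q) x = talented_action k \<Lambda> p (talented_action k \<Lambda> q x)"
  using assms(3)
proof (rule carrier_talentedE)
  fix a assume a: "set_mset a \<subseteq> talented_generators k \<Lambda>" "x = talented_congruence k \<Lambda> `` {a}"
  show ?thesis
    unfolding a talented_action_class[OF assms(2) a(1)]
      talented_action_class[OF assms(1) set_mset_shift[OF assms(2) a(1)]]
      talented_action_class[OF add_in_tuples[OF assms(1,2)] a(1)]
    by (simp add: image_mset_shift_add add.commute)
qed

lemma talented_action_zero:
  assumes "x \<in> carrier (talented_monoid k \<Lambda>)"
  shows "talented_action k \<Lambda> 0 x = x"
  using assms
proof (rule carrier_talentedE)
  fix a assume a: "set_mset a \<subseteq> talented_generators k \<Lambda>" "x = talented_congruence k \<Lambda> `` {a}"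
  show ?thesis
    unfolding a talented_action_class[OF zero_in_tuples a(1)] image_mset_shift_zero by simp
qed

lemma talented_action_hom:
  assumes "q \<in> carrier (Zvec k)"
  shows "talented_action k \<Lambda> q \<in> hom (talented_monoid k \<Lambda>) (talented_monoid k \<Lambda>)"
proof (rule homI)
  fix x assume "x \<in> carrier (talented_monoid k \<Lambda>)"
  then show "talented_action k \<Lambda> q x \<in> carrier (talented_monoid k \<Lambda>)"
    by (elim carrier_talentedE)
      (simp add: talented_action_class assms talented_monoid_def class_in_carrier set_mset_shift
        del: set_image_mset)
next
  fix x y assume "x \<in> carrier (talented_monoid k \<Lambda>)" "y \<in> carrier (talented_monoid k \<Lambda>)"
  then obtain a b where "set_mset a \<subseteq> talented_generators k \<Lambda>" "set_mset b \<subseteq> talented_generators k \<Lambda>"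
    "x = talented_congruence k \<Lambda> `` {a}" "y = talented_congruence k \<Lambda> `` {b}"
    by (elim carrier_talentedE)
  then show "talented_action k \<Lambda> q (x \<otimes>\<^bsub>talented_monoid k \<Lambda>\<^esub> y) =
      talented_action k \<Lambda> q x \<otimes>\<^bsub>talented_monoid k \<Lambda>\<^esub> talented_action k \<Lambda> q y"
    by (simp add: talented_action_class assms talented_monoid_def mult_presented set_mset_shift
        del: set_image_mset)
qed

text \<open>The action of \<open>- q\<close> is the inverse. Automorphisms are required to be
  extensional, which the restriction in \<open>talented_action\<close> provides.\<close>

lemma talented_action_auto:
  assumes q: "q \<in> carrier (Zvec k)"
  shows "talented_action k \<Lambda> q \<in> auto (talented_monoid k \<Lambda>)"
proof -
  have closed: "talented_action k \<Lambda> p x \<in> carrier (talented_monoid k \<Lambda>)"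
    if "p \<in> carrier (Zvec k)" "x \<in> carrier (talented_monoid k \<Lambda>)" for p x
    using talented_action_hom[OF that(1)] that(2) by (auto simp: hom_def)
  have "bij_betw (talented_action k \<Lambda> q) (carrier (talented_monoid k \<Lambda>)) (carrier (talented_monoid k \<Lambda>))"
    using q closed talented_action_add[of q k "- q" _ \<Lambda>] talented_action_add[of "- q" k q _ \<Lambda>]
    by (intro bij_betw_byWitness[where f' = "talented_action k \<Lambda> (- q)"])
      (auto simp: talented_action_zero)
  moreover have "talented_action k \<Lambda> q \<in> extensional (carrier (talented_monoid k \<Lambda>))"
    by (simp add: talented_action_def)
  ultimately show ?thesis
    using talented_action_hom[OF q] by (simp add: auto_def Bij_def)
qed

lemma is_grp_mon_talented: "is_grp_mon (talented_grp_mon k \<Lambda>)"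
proof -
  have "talented_action k \<Lambda> \<in> hom (Zvec k) (AutoGroup (talented_monoid k \<Lambda>))"
  proof (rule homI)
    fix q :: "nat \<Rightarrow> int" assume "q \<in> carrier (Zvec k)"
    then show "talented_action k \<Lambda> q \<in> carrier (AutoGroup (talented_monoid k \<Lambda>))"
      by (simp add: AutoGroup_def talented_action_auto)
  next
    fix p q :: "nat \<Rightarrow> int" assume pq: "p \<in> carrier (Zvec k)" "q \<in> carrier (Zvec k)"
    \<comment> \<open>The product of \<open>BijGroup\<close> is given by \<open>compose\<close> only
      for arguments in \<open>Bij\<close>.\<close>
    have Bij: "talented_action k \<Lambda> p \<in> Bij (carrier (talented_monoid k \<Lambda>))"
      "talented_action k \<Lambda> q \<in> Bij (carrier (talented_monoid k \<Lambda>))"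
      using pq talented_action_auto by (auto simp: auto_def)
    \<comment> \<open>Both sides are \<open>undefined\<close> off the carrier, so it suffices to
      compare them on it.\<close>
    have "talented_action k \<Lambda> (p + q) =
      compose (carrier (talented_monoid k \<Lambda>)) (talented_action k \<Lambda> p) (talented_action k \<Lambda> q)"
      using pq
      by (intro extensionalityI[of _ "carrier (talented_monoid k \<Lambda>)"])
        (auto simp: talented_action_add compose_def, simp add: talented_action_def)
    then show "talented_action k \<Lambda> (p \<otimes>\<^bsub>Zvec k\<^esub> q) =
      talented_action k \<Lambda> p \<otimes>\<^bsub>AutoGroup (talented_monoid k \<Lambda>)\<^esub> talented_action k \<Lambda> q"
      using Bij by (simp add: AutoGroup_def BijGroup_def)
  qed
  then show ?thesis
    by (simp add: is_grp_mon_def talented_grp_mon_def group_tuples comm_monoid_presented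
        talented_monoid_def)
qed

lemma is_grp_mon_restrict_action:
  assumes "is_grp_mon X" "group H" "F \<in> hom H (gm_grp X)"
  shows "is_grp_mon (restrict_action H F X)"
  using assms hom_compose[OF assms(3), of "gm_act X"]
  by (auto simp: is_grp_mon_def restrict_action_def comp_def)

section \<open>Pullbacks\<close>

text \<open>\<open>F_int\<close> says that \<open>F\<close> extends \<open>f\<close>. As integer
  tuples are differences of natural ones, \<open>f\<close> determines \<open>F\<close> on the
  carrier.\<close>

locale kgraph_pullback = k_graph l \<Lambda> for l and \<Lambda> :: "'a kgraph" +
  fixes k :: nat and f :: "(nat \<Rightarrow> nat) \<Rightarrow> nat \<Rightarrow> nat" and F :: "(nat \<Rightarrow> int) \<Rightarrow> nat \<Rightarrow> int"
  assumes row_finite: "row_finite_no_sources l \<Lambda>"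
    and f_hom: "f \<in> monoid_homs (Nvec k) (Nvec l)"
    and F_hom: "F \<in> hom (Zvec k) (Zvec l)"
    and F_int: "n \<in> carrier (Nvec k) \<Longrightarrow> F (\<lambda>i. int (n i)) = (\<lambda>j. int (f n j))"
begin

abbreviation pullback where "pullback \<equiv> pullback_kgraph k f \<Lambda>"

lemma f_closed: "n \<in> carrier (Nvec k) \<Longrightarrow> f n \<in> carrier (Nvec l)"
  and f_add: "m \<in> carrier (Nvec k) \<Longrightarrow> n \<in> carrier (Nvec k) \<Longrightarrow> f (m + n) = f m + f n"
  and f_zero: "f 0 = 0"
  using f_hom by (auto simp: monoid_homs_def hom_def)

lemma F_closed: "n \<in> carrier (Zvec k) \<Longrightarrow> F n \<in> carrier (Zvec l)"
  and F_add: "m \<in> carrier (Zvec k) \<Longrightarrow> n \<in> carrier (Zvec k) \<Longrightarrow> F (m + n) = F m + F n"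
  using F_hom by (auto simp: hom_def)

lemma F_diff: "m \<in> carrier (Zvec k) \<Longrightarrow> n \<in> carrier (Zvec k) \<Longrightarrow> F (m - n) = F m - F n"
  using F_add[of "m - n" n] by simp

text \<open>Factoring \<open>(y, n + m)\<close> amounts to factoring \<open>y\<close> in
  \<open>\<Lambda>\<close> with degrees \<open>f n\<close> and \<open>f m\<close>, since the second
  components are forced to be \<open>n\<close> and \<open>m\<close>.\<close>

lemma pullback_k_graph: "k_graph k pullback"
proof
  show "countable (kg_mor pullback)"
  proof (rule countable_subset)
    show "kg_mor pullback \<subseteq> kg_mor \<Lambda> \<times> carrier (Nvec k)"
      by (auto simp: pullback_kgraph_def)
    show "countable (kg_mor \<Lambda> \<times> carrier (Nvec k))"
      by (intro countable_SIGMA countable_mor countable_Nvec)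
  qed
next
  fix x n m
  assume x: "x \<in> kg_mor pullback" and nm: "n \<in> carrier (Nvec k)" "m \<in> carrier (Nvec k)"
    and d: "kg_d pullback x = n + m"
  obtain y where y: "x = (y, n + m)" "y \<in> kg_mor \<Lambda>" "kg_d \<Lambda> y = f n + f m"
    using x d nm by (auto simp: pullback_kgraph_def f_add)
  from y(2) f_closed[OF nm(1)] f_closed[OF nm(2)] y(3)
  obtain \<alpha> \<beta> where ab: "\<alpha> \<in> kg_mor \<Lambda>" "\<beta> \<in> kg_mor \<Lambda>" "kg_s \<Lambda> \<alpha> = kg_r \<Lambda> \<beta>"
    "kg_d \<Lambda> \<alpha> = f n" "kg_d \<Lambda> \<beta> = f m" "y = kg_comp \<Lambda> \<alpha> \<beta>"
    by (rule factorizationE)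
  show "\<exists>!(\<alpha>, \<beta>). \<alpha> \<in> kg_mor pullback \<and> \<beta> \<in> kg_mor pullback \<and>
      kg_s pullback \<alpha> = kg_r pullback \<beta> \<and> kg_d pullback \<alpha> = n \<and> kg_d pullback \<beta> = m \<and>
      x = kg_comp pullback \<alpha> \<beta>"
  proof (rule ex1I[of _ "((\<alpha>, n), (\<beta>, m))"])
    show "case ((\<alpha>, n), (\<beta>, m)) of (\<alpha>, \<beta>) \<Rightarrow> \<alpha> \<in> kg_mor pullback \<and> \<beta> \<in> kg_mor pullback \<and>
        kg_s pullback \<alpha> = kg_r pullback \<beta> \<and> kg_d pullback \<alpha> = n \<and> kg_d pullback \<beta> = m \<and>
        x = kg_comp pullback \<alpha> \<beta>"
      using ab nm y by (simp add: pullback_kgraph_def)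
  next
    fix z assume "case z of (\<alpha>, \<beta>) \<Rightarrow> \<alpha> \<in> kg_mor pullback \<and> \<beta> \<in> kg_mor pullback \<and>
        kg_s pullback \<alpha> = kg_r pullback \<beta> \<and> kg_d pullback \<alpha> = n \<and> kg_d pullback \<beta> = m \<and>
        x = kg_comp pullback \<alpha> \<beta>"
    moreover obtain \<gamma> n' \<delta> m' where z: "z = ((\<gamma>, n'), (\<delta>, m'))"
      by (metis surj_pair)
    ultimately have \<gamma>\<delta>: "\<gamma> \<in> kg_mor \<Lambda>" "\<delta> \<in> kg_mor \<Lambda>" "kg_s \<Lambda> \<gamma> = kg_r \<Lambda> \<delta>"
      "kg_d \<Lambda> \<gamma> = f n" "kg_d \<Lambda> \<delta> = f m" "y = kg_comp \<Lambda> \<gamma> \<delta>" "n' = n" "m' = m"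
      by (auto simp: pullback_kgraph_def y(1))
    have "\<gamma> = \<alpha> \<and> \<delta> = \<beta>"
      using factorization_unique[OF ab(1-3) \<gamma>\<delta>(1-3)] \<gamma>\<delta>(4-6) ab(4-6) by metis
    then show "z = ((\<alpha>, n), (\<beta>, m))"
      by (simp add: z \<gamma>\<delta>(7,8))
  qed
next
  \<comment> \<open>\<open>(kg_s \<Lambda> x, 0)\<close> is a morphism of the pullback because
    \<open>kg_s \<Lambda> x\<close> has degree \<open>0 = f 0\<close>, by
    \<open>s_in_vertices\<close>.\<close>
  fix x assume "x \<in> kg_mor pullback"
  then show "kg_s pullback x \<in> kg_mor pullback"
    using s_in_vertices by (auto simp: pullback_kgraph_def f_zero kg_vertices_def)
qed (auto simp: pullback_kgraph_def r_closed r_r s_r r_s s_s comp_closed r_comp s_comp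
    comp_assoc comp_r comp_s d_identity d_comp f_zero f_add add.assoc)

lemma pullback_vertices: "kg_vertices pullback = kg_vertices \<Lambda> \<times> {0}"
  by (auto simp: kg_vertices_def pullback_kgraph_def f_zero)

lemma pullback_paths:
  "n \<in> carrier (Nvec k) \<Longrightarrow> kg_paths pullback (v, 0) n = (\<lambda>\<alpha>. (\<alpha>, n)) ` kg_paths \<Lambda> v (f n)"
  by (auto simp: kg_paths_def pullback_kgraph_def)

lemma pullback_row_finite: "row_finite_no_sources k pullback"
  using row_finite f_closed
  by (auto simp: row_finite_no_sources_def pullback_vertices pullback_paths)

lemma sum_pullback_paths:
  assumes "p \<in> carrier (Nvec k)"
  shows "(\<Sum>\<alpha>\<in>kg_paths pullback (v, 0) p. g (kg_s pullback \<alpha>)) =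
    (\<Sum>\<alpha>\<in>kg_paths \<Lambda> v (f p). g (kg_s \<Lambda> \<alpha>, 0))"
  unfolding pullback_paths[OF assms]
  by (subst sum.reindex) (auto simp: inj_on_def pullback_kgraph_def)

text \<open>With the sum taken over paths of \<open>\<Lambda>\<close>, expansions along different
  \<open>p\<close> become comparable through the values \<open>f p\<close>.\<close>

lemma pullback_path_relation:
  assumes "v \<in> kg_vertices \<Lambda>" "n \<in> carrier (Zvec k)" "p \<in> carrier (Nvec k)"
  shows "({#((v, 0), n)#}, \<Sum>\<alpha>\<in>kg_paths \<Lambda> v (f p). {#((kg_s \<Lambda> \<alpha>, 0), n + (\<lambda>j. int (p j)))#})
    \<in> talented_congruence k pullback"
  using k_graph.talented_path_relation[OF pullback_k_graph pullback_row_finite _ assms(2,3),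
      of "(v, 0)"] assms(1)
    sum_pullback_paths[OF assms(3), of "\<lambda>w. {#(w, n + (\<lambda>j. int (p j)))#}" v]
  by (simp add: pullback_vertices)

text \<open>In contrast to \<open>pullback_path_relation\<close>, \<open>q\<close> may have negative
  coordinates; only \<open>F q\<close> must be nonnegative. It is applied with \<open>p\<close> a
  unit tuple, to see that the inverse respects the relations, and with \<open>p = 0\<close>, to
  identify \<open>v(n)\<close> and \<open>v(n')\<close> when \<open>F n = F n'\<close>.\<close>

lemma pullback_relation:
  assumes v: "v \<in> kg_vertices \<Lambda>" and n: "n \<in> carrier (Zvec k)" and q: "q \<in> carrier (Zvec k)"
    and p: "p \<in> carrier (Nvec l)" and Fq: "F q = (\<lambda>j. int (p j))"
  shows "({#((v, 0), n)#}, \<Sum>\<alpha>\<in>kg_paths \<Lambda> v p. {#((kg_s \<Lambda> \<alpha>, 0), n + q)#})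
    \<in> talented_congruence k pullback"
proof -
  obtain a b where ab: "a \<in> carrier (Nvec k)" "b \<in> carrier (Nvec k)"
    and q_eq: "q = (\<lambda>i. int (a i)) - (\<lambda>i. int (b i))"
    using q by (rule Zvec_as_difference)
  have "F q = (\<lambda>j. int (f a j)) - (\<lambda>j. int (f b j))"
    using ab by (simp add: q_eq F_diff F_int)
  with Fq have "(\<lambda>j. int (p j)) = (\<lambda>j. int (f a j)) - (\<lambda>j. int (f b j))" by simp
  \<comment> \<open>Moving \<open>f b\<close> to the other side lets injectivity of
    \<open>int\<close> yield an equation of natural tuples.\<close>
  from fun_cong[OF this] have "int (f a j) = int (p j + f b j)" for j by simp
  then have fa: "f a = p + f b"
    by (intro ext) (simp only: of_nat_eq_iff plus_fun_apply)
  let ?n = "n + (\<lambda>j. int (a j))"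
  \<comment> \<open>Since \<open>q = a - b\<close>, shifting by \<open>q\<close> and then by
    \<open>b\<close> ends where shifting by \<open>a\<close> does.\<close>
  have shift: "n + q + (\<lambda>j. int (b j)) = ?n"
    by (simp add: q_eq add.assoc)
  have "({#((v, 0), n)#}, \<Sum>\<alpha>\<in>kg_paths \<Lambda> v (p + f b). {#((kg_s \<Lambda> \<alpha>, 0), ?n)#})
      \<in> talented_congruence k pullback"
    using pullback_path_relation[OF v n ab(1)] by (simp add: fa)
  also have "(\<Sum>\<alpha>\<in>kg_paths \<Lambda> v (p + f b). {#((kg_s \<Lambda> \<alpha>, 0), ?n)#}) =
      (\<Sum>\<alpha>\<in>kg_paths \<Lambda> v p. \<Sum>\<beta>\<in>kg_paths \<Lambda> (kg_s \<Lambda> \<alpha>) (f b). {#((kg_s \<Lambda> \<beta>, 0), ?n)#})"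
    using sum_paths_add[OF row_finite v p f_closed[OF ab(2)], of "\<lambda>w. {#((w, 0), ?n)#}"] .
  finally have "({#((v, 0), n)#},
      \<Sum>\<alpha>\<in>kg_paths \<Lambda> v p. \<Sum>\<beta>\<in>kg_paths \<Lambda> (kg_s \<Lambda> \<alpha>) (f b). {#((kg_s \<Lambda> \<beta>, 0), ?n)#})
      \<in> talented_congruence k pullback" .
  moreover have "(\<Sum>\<alpha>\<in>kg_paths \<Lambda> v p. {#((kg_s \<Lambda> \<alpha>, 0), n + q)#},
      \<Sum>\<alpha>\<in>kg_paths \<Lambda> v p. \<Sum>\<beta>\<in>kg_paths \<Lambda> (kg_s \<Lambda> \<alpha>) (f b). {#((kg_s \<Lambda> \<beta>, 0), ?n)#})
      \<in> talented_congruence k pullback"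
  proof (rule gen_congruence_sum)
    fix \<alpha> assume "\<alpha> \<in> kg_paths \<Lambda> v p"
    from pullback_path_relation[OF s_path_in_vertices[OF this] add_in_tuples[OF n q] ab(2)]
    show "({#((kg_s \<Lambda> \<alpha>, 0), n + q)#},
        \<Sum>\<beta>\<in>kg_paths \<Lambda> (kg_s \<Lambda> \<alpha>) (f b). {#((kg_s \<Lambda> \<beta>, 0), ?n)#}) \<in> talented_congruence k pullback"
      unfolding shift .
  qed
  ultimately show ?thesis
    by (blast intro: gen_congruence.trans gen_congruence.sym)
qed

section \<open>The homomorphism induced by \<open>F\<close>\<close>

definition to_base :: "('a \<times> (nat \<Rightarrow> nat)) \<times> (nat \<Rightarrow> int) \<Rightarrow> 'a \<times> (nat \<Rightarrow> int)" where
  "to_base = (\<lambda>(v, n). (fst v, F n))"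

text \<open>A unit step in the pullback becomes a step along \<open>f (unit_tuple i)\<close> in
  \<open>\<Lambda>\<close>, which need not be a unit tuple; hence the appeal to
  \<open>talented_path_relation\<close>.\<close>

sublocale to_base: presented_hom "talented_generators k pullback" "talented_relations k pullback"
  "talented_generators l \<Lambda>" "talented_relations l \<Lambda>" to_base
proof
  show "to_base ` talented_generators k pullback \<subseteq> talented_generators l \<Lambda>"
    by (auto simp: talented_generators_def pullback_vertices to_base_def F_closed)
  fix a b
  assume "(a, b) \<in> talented_relations k pullback"
  then obtain v n i where vni: "v \<in> kg_vertices \<Lambda>" "n \<in> carrier (Zvec k)" "i < k"
    "a = {#((v, 0), n)#}"
    "b = (\<Sum>\<alpha>\<in>kg_paths pullback (v, 0) (unit_tuple i). {#(kg_s pullback \<alpha>, n + unit_tuple i)#})"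
    unfolding talented_relations_def pullback_vertices by blast
  have F_unit: "F (n + unit_tuple i) = F n + (\<lambda>j. int (f (unit_tuple i) j))"
    using vni F_int[OF unit_in_tuples[OF vni(3)]] by (simp add: F_add unit_in_tuples int_unit_tuple)
  have "image_mset to_base b =
      (\<Sum>\<alpha>\<in>kg_paths pullback (v, 0) (unit_tuple i). {#(fst (kg_s pullback \<alpha>), F (n + unit_tuple i))#})"
    by (simp add: vni image_mset_sum to_base_def)
  also have "\<dots> = (\<Sum>\<alpha>\<in>kg_paths \<Lambda> v (f (unit_tuple i)).
      {#(kg_s \<Lambda> \<alpha>, F n + (\<lambda>j. int (f (unit_tuple i) j)))#})"
    using sum_pullback_paths[OF unit_in_tuples[OF vni(3)],
        of "\<lambda>w. {#(fst w, F (n + unit_tuple i))#}" v] by (simp add: F_unit)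
  finally show "(image_mset to_base a, image_mset to_base b) \<in> talented_congruence l \<Lambda>"
    using talented_path_relation[OF row_finite vni(1) F_closed[OF vni(2)]
        f_closed[OF unit_in_tuples[OF vni(3)]]] vni
    by (simp add: to_base_def)
qed

abbreviation rho where
  "rho \<equiv> presented_map (talented_generators l \<Lambda>) (talented_relations l \<Lambda>) to_base"

lemma rho_monoid_homs: "rho \<in> monoid_homs (talented_monoid k pullback) (talented_monoid l \<Lambda>)"
  unfolding talented_monoid_def by (rule to_base.map_monoid_homs)

text \<open>On generators both sides give \<open>v(F n + F q)\<close>. As \<open>F_add\<close> holds
  on the carrier, the multisets are compared over members of \<open>a\<close>.\<close>

lemma rho_equivariant:
  assumes q: "q \<in> carrier (Zvec k)" and "x \<in> carrier (talented_monoid k pullback)"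
  shows "rho (talented_action k pullback q x) = talented_action l \<Lambda> (F q) (rho x)"
  using assms(2)
proof (rule carrier_talentedE)
  fix a
  assume a: "set_mset a \<subseteq> talented_generators k pullback" "x = talented_congruence k pullback `` {a}"
  have "image_mset to_base (image_mset (\<lambda>(v, n). (v, n + q)) a) =
      image_mset (\<lambda>(v, n). (v, n + F q)) (image_mset to_base a)"
    using a(1) q unfolding multiset.map_comp
    by (intro image_mset_cong) (auto simp: to_base_def talented_generators_def F_add)
  then show ?thesis
    unfolding a talented_action_class[OF q a(1)] to_base.map_class[OF a(1)]
      to_base.map_class[OF set_mset_shift[OF q a(1)]]
      talented_action_class[OF F_closed[OF q] to_base.image_generators[OF a(1)]]
    by simp
qed

section \<open>The surjective case\<close>

lemma F_surj_if_f_surj: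
  assumes "f ` carrier (Nvec k) = carrier (Nvec l)"
  shows "F ` carrier (Zvec k) = carrier (Zvec l)"
proof
  show "F ` carrier (Zvec k) \<subseteq> carrier (Zvec l)"
    using F_closed by auto
  show "carrier (Zvec l) \<subseteq> F ` carrier (Zvec k)"
  proof
    fix m :: "nat \<Rightarrow> int" assume "m \<in> carrier (Zvec l)"
    \<comment> \<open>Both nonnegative parts of \<open>m\<close> are lifted through
      \<open>f\<close>; the difference of the lifts maps to \<open>m\<close>.\<close>
    then obtain a b where ab: "a \<in> carrier (Nvec l)" "b \<in> carrier (Nvec l)"
      and m: "m = (\<lambda>i. int (a i)) - (\<lambda>i. int (b i))"
      by (rule Zvec_as_difference)
    from ab(1) obtain a' where "a' \<in> carrier (Nvec k)" "a = f a'"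
      unfolding assms[symmetric] by (rule imageE)
    moreover from ab(2) obtain b' where "b' \<in> carrier (Nvec k)" "b = f b'"
      unfolding assms[symmetric] by (rule imageE)
    ultimately show "m \<in> F ` carrier (Zvec k)"
      unfolding m by (intro image_eqI[of _ _ "(\<lambda>i. int (a' i)) - (\<lambda>i. int (b' i))"])
        (auto simp: F_diff F_int)
  qed
qed

text \<open>Surjectivity of \<open>F\<close> is weaker than that of \<open>f\<close>: the map
  \<open>f(a, b) = 2a + 3b\<close> misses 1, but its extension to integers is onto.\<close>

lemma rho_iso:
  assumes surj: "F ` carrier (Zvec k) = carrier (Zvec l)"
  shows "rho \<in> iso (talented_monoid k pullback) (talented_monoid l \<Lambda>)"
proof -
  \<comment> \<open>Only a section of sets: \<open>G\<close> need not be additive, and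
    \<open>pullback_relation\<close> absorbs the defect.\<close>
  define G where "G = inv_into (carrier (Zvec k)) F"
  have G: "G m \<in> carrier (Zvec k)" "F (G m) = m" if "m \<in> carrier (Zvec l)" for m
    using that surj by (auto simp: G_def inv_into_into f_inv_into_f)
  define \<psi> :: "'a \<times> (nat \<Rightarrow> int) \<Rightarrow> ('a \<times> (nat \<Rightarrow> nat)) \<times> (nat \<Rightarrow> int)"
    where "\<psi> = (\<lambda>(v, m). ((v, 0), G m))"
  have "presented_hom (talented_generators l \<Lambda>) (talented_relations l \<Lambda>)
    (talented_generators k pullback) (talented_relations k pullback) \<psi>"
  proof
    show "\<psi> ` talented_generators l \<Lambda> \<subseteq> talented_generators k pullback"
      by (auto simp: talented_generators_def pullback_vertices \<psi>_def G)
    fix a b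
    assume "(a, b) \<in> talented_relations l \<Lambda>"
    then obtain v m i where vmi: "v \<in> kg_vertices \<Lambda>" "m \<in> carrier (Zvec l)" "i < l"
      "a = {#(v, m)#}"
      "b = (\<Sum>\<alpha>\<in>kg_paths \<Lambda> v (unit_tuple i). {#(kg_s \<Lambda> \<alpha>, m + unit_tuple i)#})"
      unfolding talented_relations_def by blast
    have m': "m + unit_tuple i \<in> carrier (Zvec l)"
      using vmi by (simp add: unit_in_tuples)
    \<comment> \<open>The shift from \<open>G m\<close> to \<open>G (m + unit_tuple i)\<close> may
      have negative entries, but it lies over a unit tuple.\<close>
    have "F (G (m + unit_tuple i) - G m) = (\<lambda>j. int (unit_tuple i j))"
      using vmi m' by (simp add: F_diff G int_unit_tuple)
    from pullback_relation[OF vmi(1) G(1)[OF vmi(2)]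
        diff_in_tuples[OF G(1)[OF m'] G(1)[OF vmi(2)]] unit_in_tuples[OF vmi(3)] this]
    show "(image_mset \<psi> a, image_mset \<psi> b) \<in> talented_congruence k pullback"
      by (simp add: vmi image_mset_sum \<psi>_def)
  qed
  moreover have "({#\<psi> (to_base x)#}, {#x#}) \<in> talented_congruence k pullback"
    if gen: "x \<in> talented_generators k pullback" for x
  proof -
    obtain v n where x: "x = ((v, 0), n)" "v \<in> kg_vertices \<Lambda>" "n \<in> carrier (Zvec k)"
      using gen by (auto simp: talented_generators_def pullback_vertices)
    \<comment> \<open>\<open>n\<close> and \<open>G (F n)\<close> differ by an element of the kernel
      of \<open>F\<close>. With \<open>p = 0\<close> the only path at \<open>v\<close> is
      \<open>v\<close>, so \<open>pullback_relation\<close> reads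
      \<open>v(G (F n)) = v(n)\<close>.\<close>
    have "F (n - G (F n)) = (\<lambda>j. int (0 j))"
      using x by (auto simp: F_diff G F_closed)
    from pullback_relation[OF x(2) G(1)[OF F_closed[OF x(3)]]
        diff_in_tuples[OF x(3) G(1)[OF F_closed[OF x(3)]]] zero_in_tuples this]
    show ?thesis
      unfolding paths_zero[OF x(2)] using x by (simp add: s_vertex \<psi>_def to_base_def)
  qed
  moreover have "to_base (\<psi> y) = y" if "y \<in> talented_generators l \<Lambda>" for y
    using that by (auto simp: talented_generators_def \<psi>_def to_base_def G)
  ultimately show ?thesis
    unfolding talented_monoid_def by (rule to_base.map_iso)
qed

end

text \<open>Bijectivity of \<open>\<rho>\<close> is established under either reading of
  surjectivity: for \<open>f\<close> on natural tuples or for its extension \<open>F\<close> on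
  integer ones.\<close>

theorem proposition3p2p1:
  fixes \<Lambda> :: "'a kgraph" and k l :: nat
    and f :: "(nat \<Rightarrow> nat) \<Rightarrow> (nat \<Rightarrow> nat)"
    and F :: "(nat \<Rightarrow> int) \<Rightarrow> (nat \<Rightarrow> int)"
  assumes "k_graph l \<Lambda>"
    and "row_finite_no_sources l \<Lambda>"
    and "f \<in> monoid_homs (Nvec k) (Nvec l)"
    and "F \<in> hom (Zvec k) (Zvec l)"
    and "\<forall>n \<in> carrier (Nvec k). F (\<lambda>i. int (n i)) = (\<lambda>j. int (f n j))"
  shows "\<exists>\<rho>.
    \<rho> \<in> monoid_homs (talented_monoid k (pullback_kgraph k f \<Lambda>)) (talented_monoid l \<Lambda>) \<and>
    equivariant_hom (talented_grp_mon k (pullback_kgraph k f \<Lambda>))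
      (restrict_action (Zvec k) F (talented_grp_mon l \<Lambda>)) (id, \<rho>) \<and>
    equivariant_hom (restrict_action (Zvec k) F (talented_grp_mon l \<Lambda>))
      (talented_grp_mon l \<Lambda>) (F, id) \<and>
    equivariant_hom (talented_grp_mon k (pullback_kgraph k f \<Lambda>))
      (talented_grp_mon l \<Lambda>) (F, \<rho>) \<and>
    grp_mon_comp (F, id) (id, \<rho>) = (F, \<rho>) \<and>
    (f ` carrier (Nvec k) = carrier (Nvec l) \<or> F ` carrier (Zvec k) = carrier (Zvec l)
      \<longrightarrow> \<rho> \<in> iso (talented_monoid k (pullback_kgraph k f \<Lambda>)) (talented_monoid l \<Lambda>))"
proof -
  interpret kgraph_pullback l \<Lambda> k f F
    by (intro kgraph_pullback.intro kgraph_pullback_axioms.intro) (use assms in auto)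
  let ?X = "talented_grp_mon k (pullback_kgraph k f \<Lambda>)"
  let ?Y = "talented_grp_mon l \<Lambda>"
  let ?Z = "restrict_action (Zvec k) F ?Y"
  have grp_mon: "is_grp_mon ?X" "is_grp_mon ?Y" "is_grp_mon ?Z"
    using is_grp_mon_restrict_action[OF is_grp_mon_talented group_tuples, of F k l \<Lambda>] F_hom
    by (simp_all add: is_grp_mon_talented) (simp add: talented_grp_mon_def)
  \<comment> \<open>Both claims rest on \<open>rho_equivariant\<close>, as \<open>q\<close> acts on
    \<open>?Z\<close> in the way \<open>F q\<close> acts on \<open>?Y\<close>.\<close>
  have "equivariant_hom ?X ?Z (id, rho)" "equivariant_hom ?X ?Y (F, rho)"
    using grp_mon rho_monoid_homs rho_equivariant F_hom
    by (auto simp: equivariant_hom_def restrict_action_def talented_grp_mon_def hom_def)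
  moreover have "equivariant_hom ?Z ?Y (F, id)"
    using grp_mon F_hom
    by (auto simp: equivariant_hom_def restrict_action_def talented_grp_mon_def monoid_homs_def hom_def)
  moreover have "grp_mon_comp (F, id) (id, rho) = (F, rho)"
    by (simp add: grp_mon_comp_def)
  ultimately show ?thesis
    using rho_monoid_homs rho_iso F_surj_if_f_surj by blast
qed

end
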